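(* Let $\varphi_1,\varphi_2$ be real numbers and let $f\in L([a,b];\mathbb{C})$ have the property that $$0\le\varphi_1\le\arg f(t)\le\varphi_2<\frac{\pi}{2}$$ for a.e. $t\in[a,b]$. Then $$\sqrt{\sin^2\varphi_1+\cos^2\varphi_2}\int_a^b|f(t)|\,dt\le\left|\int_a^b f(t)\,dt\right|.$$ Equality holds in this inequality if and only if $$\int_a^b f(t)\,dt=(\cos\varphi_2+i\sin\varphi_1)\int_a^b|f(t)|\,dt.$$
   Context: $L([a,b];\mathbb{C})$ denotes the set of Lebesgue integrable functions $f:[a,b]\to\mathbb{C}$. $\arg$ denotes the principal argument of a complex number, and $i$ is the imaginary unit. *)

theory Defs
  imports "HOL-Analysis.Analysis"
begin

end

theory Submission imports Defs begin

text \<open>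
  The argument condition says \<open>Re (f t) \<ge> cos \<phi>2 * cmod (f t)\<close> and
  \<open>Im (f t) \<ge> sin \<phi>1 * cmod (f t)\<close>. Integrating these two bounds, whose right-hand sides are
  nonnegative, and taking the norm gives the inequality; equality of the norms forces equality in
  both coordinates.
\<close>

lemma cmod_coordinate_bounds:
  assumes "0 \<le> x" "0 \<le> y" "x \<le> Re z" "y \<le> Im z"
  shows "cmod (Complex x y) \<le> cmod z" and "cmod (Complex x y) = cmod z \<longleftrightarrow> z = Complex x y"
proof -
  have sq: "x\<^sup>2 \<le> (Re z)\<^sup>2" "y\<^sup>2 \<le> (Im z)\<^sup>2"
    using assms by (auto intro: power_mono)
  show "cmod (Complex x y) \<le> cmod z"
    using sq by (simp add: cmod_def)
  show "cmod (Complex x y) = cmod z \<longleftrightarrow> z = Complex x y"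
  proof
    assume "cmod (Complex x y) = cmod z"
    then have "x\<^sup>2 + y\<^sup>2 = (Re z)\<^sup>2 + (Im z)\<^sup>2"
      by (simp add: cmod_def)
    \<comment> \<open>Two inequalities whose sums agree are both equalities; nonnegativity of all
      four coordinates then removes the squares.\<close>
    with sq have "x\<^sup>2 = (Re z)\<^sup>2" "y\<^sup>2 = (Im z)\<^sup>2"
      by linarith+
    with assms show "z = Complex x y"
      by (auto simp: complex_eq_iff power2_eq_iff_nonneg)
  qed simp
qed

text \<open>For nonzero \<open>z\<close> the angle lies in [0, pi/2), where cos decreases and sin
  increases; scaling by \<open>cmod z\<close> gives both bounds. At \<open>z = 0\<close>, where the
  argument carries no information, both read 0 \<le> 0.\<close>

lemma Arg_sector_bounds:
  assumes "0 \<le> \<alpha>" "\<beta> < pi / 2" "z \<noteq> 0 \<longrightarrow> \<alpha> \<le> Arg z \<and> Arg z \<le> \<beta>"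
  shows "cos \<beta> * cmod z \<le> Re z" and "sin \<alpha> * cmod z \<le> Im z"
proof -
  have "cos \<beta> * cmod z \<le> Re z \<and> sin \<alpha> * cmod z \<le> Im z"
  proof (cases "z = 0")
    case False
    then have A: "\<alpha> \<le> Arg z" "Arg z \<le> \<beta>"
      using assms by auto
    have "cos \<beta> \<le> cos (Arg z)"
      using A assms by (intro cos_monotone_0_pi_le) auto
    moreover have "sin \<alpha> \<le> sin (Arg z)"
      using A assms by (intro sin_monotone_2pi_le) auto
    moreover have "Re z = cos (Arg z) * cmod z" "Im z = sin (Arg z) * cmod z"
      using False by (simp_all add: cos_Arg sin_Arg)
    ultimately show ?thesis
      by (simp add: mult_right_mono)
  qed simp
  then show "cos \<beta> * cmod z \<le> Re z" "sin \<alpha> * cmod z \<le> Im z"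
    by auto
qed

theorem proposition1:
  fixes a b \<phi>1 \<phi>2 :: real and f :: "real \<Rightarrow> complex"
  assumes "a \<le> b"
    and "integrable (lebesgue_on {a..b}) f"
    and "0 \<le> \<phi>1" and "\<phi>2 < pi / 2"
    and "AE t in lebesgue_on {a..b}. f t \<noteq> 0 \<longrightarrow> \<phi>1 \<le> Arg (f t) \<and> Arg (f t) \<le> \<phi>2"
  shows "sqrt ((sin \<phi>1)\<^sup>2 + (cos \<phi>2)\<^sup>2) * (LINT t|lebesgue_on {a..b}. cmod (f t))
           \<le> cmod (LINT t|lebesgue_on {a..b}. f t)
       \<and> (sqrt ((sin \<phi>1)\<^sup>2 + (cos \<phi>2)\<^sup>2) * (LINT t|lebesgue_on {a..b}. cmod (f t))
             = cmod (LINT t|lebesgue_on {a..b}. f t)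
           \<longleftrightarrow> (LINT t|lebesgue_on {a..b}. f t)
             = (complex_of_real (cos \<phi>2) + \<i> * complex_of_real (sin \<phi>1))
                 * complex_of_real (LINT t|lebesgue_on {a..b}. cmod (f t)))"
proof -
  let ?M = "lebesgue_on {a..b}"
  define I where "I = (LINT t|?M. cmod (f t))"
  define F where "F = (LINT t|?M. f t)"
  \<comment> \<open>The extremal value: \<open>cmod z\<close> is the left side of the inequality and
    \<open>F = z\<close> is the equality condition, so only \<open>z\<close> and \<open>F\<close>
    need comparing.\<close>
  define z where "z = Complex (cos \<phi>2 * I) (sin \<phi>1 * I)"
  have I0: "0 \<le> I"
    unfolding I_def by simp
  have norm_z: "cmod z = sqrt ((sin \<phi>1)\<^sup>2 + (cos \<phi>2)\<^sup>2) * I"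
    using I0 by (simp add: z_def cmod_def power_mult_distrib real_sqrt_mult add.commute
        flip: distrib_right)
  have z_eq: "z = (complex_of_real (cos \<phi>2) + \<i> * complex_of_real (sin \<phi>1)) * complex_of_real I"
    by (simp add: z_def complex_eq_iff)
  have "cmod z \<le> cmod F \<and> (cmod z = cmod F \<longleftrightarrow> F = z)"
  \<comment> \<open>The order of the two angles is not among the hypotheses, but it puts both in [0,
    pi/2), which makes the coordinates of \<open>z\<close> nonnegative.\<close>
  proof (cases "\<phi>1 \<le> \<phi>2")
    case True
    have "(LINT t|?M. cos \<phi>2 * cmod (f t)) \<le> (LINT t|?M. Re (f t))"
      using assms(2,5) Arg_sector_bounds(1)[OF assms(3,4)]
      by (intro integral_mono_AE) (auto elim: eventually_mono)
    \<comment> \<open>\<open>Re\<close> commutes with the integral because \<open>f\<close> is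
      integrable; likewise \<open>Im\<close> below.\<close>
    then have Re: "cos \<phi>2 * I \<le> Re F"
      using assms(2) by (simp add: I_def F_def)
    have "(LINT t|?M. sin \<phi>1 * cmod (f t)) \<le> (LINT t|?M. Im (f t))"
      using assms(2,5) Arg_sector_bounds(2)[OF assms(3,4)]
      by (intro integral_mono_AE) (auto elim: eventually_mono)
    then have Im: "sin \<phi>1 * I \<le> Im F"
      using assms(2) by (simp add: I_def F_def)
    have "0 \<le> cos \<phi>2" "0 \<le> sin \<phi>1"
      using True assms(3,4) by (auto intro!: cos_ge_zero sin_ge_zero)
    with I0 cmod_coordinate_bounds[OF _ _ Re Im] show ?thesis
      by (simp add: z_def)
  next
    case False
    \<comment> \<open>The sector is empty, so \<open>f\<close> vanishes almost everywhere; then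
      \<open>F = z = 0\<close> and equality holds on both sides of the equivalence.\<close>
    then have "AE t in ?M. f t = 0"
      using assms(5) by (auto elim: eventually_mono)
    then have "F = 0" "I = 0"
      unfolding F_def I_def by (auto intro!: integral_eq_zero_AE elim: eventually_mono)
    then show ?thesis
      by (simp add: z_def Complex_eq)
  qed
  then show ?thesis
    unfolding norm_z unfolding z_eq I_def F_def .
qed

end
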